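(* Let $G$ be a mixed graph, $G^*$ its associated digraph, and $\ell\ge 1$. Then the sequence mixed graph $S^{\ell}(G)$ can be obtained from the $\ell$-iterated line digraph $L^{\ell}(G^* )$ by identifying each vertex $\mathbf{u}=u_0u_1\dots u_{\ell-1}u_\ell$ with its conjugate $\overline{\mathbf{u}}=u_\ell u_{\ell-1}\dots u_1u_0$ whenever the latter is also a vertex of $L^{\ell}(G^* )$, and replacing the resulting digons (pairs of opposite arcs) by edges.
   Context: A mixed graph $G$ has (undirected) edges and (directed) arcs, with no loops; its associated digraph $G^*$ is obtained by replacing each edge by two opposite arcs (a digon). A walk of length $\ell$ is a sequence $u_0u_1\dots u_\ell$ such that each $(u_{i-1},u_i)$ is an edge or an arc from $u_{i-1}$ to $u_i$; it is undirected if it uses only edges. The conjugate of $u_0\dots u_\ell$ is $u_\ell\dots u_0$. For a digraph $D$, the $\ell$-iterated line digraph $L^{\ell}(D)$ has as vertices the walks $u_0u_1\dots u_\ell$ of length $\ell$ in $D$, with an arc from $u_0u_1\dots u_\ell$ to each $u_1u_2\dots u_\ell u_{\ell+1}$ such that $(u_\ell,u_{\ell+1})$ is an arc of $D$. The sequence mixed graph $S^{\ell}(G)$: its vertices are the walks of length $\ell$ of $G$, where a walk and its conjugate are regarded as the same vertex if and only if the walk is undirected. For distinct vertices $\mathbf{x},\mathbf{y}$ of $S^{\ell}(G)$, there is an adjacency from $\mathbf{x}$ to $\mathbf{y}$ if there is a walk $u_0u_1\dots u_{\ell+1}$ in $G$ with $u_0\dots u_\ell$ representing $\mathbf{x}$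 and $u_1\dots u_{\ell+1}$ representing $\mathbf{y}$; this adjacency is an edge if such a walk uses only edges of $G$, and an arc from $\mathbf{x}$ to $\mathbf{y}$ otherwise. Loops are not considered.
   Formalization: The mixed graph is assumed to have two opposite arcs between two vertices only where the edge joining them is also present; without this the claim fails, e.g. for two vertices joined by two opposite arcs and no edge, with ℓ = 1. *)

theory Defs
  imports "Graph_Theory.Pair_Digraph" "Graph_Theory.Vertex_Walk"
begin

text \<open>
  The edge joining \<open>u\<close> and \<open>v\<close> is the two-element set \<open>{u, v}\<close>; an arc is an
  ordered pair.
\<close>

record 'a pre_mixed_graph =
  mverts :: "'a set"
  medges :: "'a set set"
  marcs :: "'a rel"

text \<open>
  Two opposite arcs are the same thing as an edge, which is what makes a mixed graph recoverable
  from its associated digraph. Hence a pair of opposite arcs is only admitted where the edge is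
  present. In particular every mixed graph in which two vertices are joined by at most one edge
  or arc is covered. Finiteness is not required.
\<close>

locale mixed_graph =
  fixes G :: "'a pre_mixed_graph"
  assumes edge_wf: "e \<in> medges G \<Longrightarrow> \<exists>u\<in>mverts G. \<exists>v\<in>mverts G. u \<noteq> v \<and> e = {u, v}"
    and arc_wf: "(u, v) \<in> marcs G \<Longrightarrow> u \<in> mverts G \<and> v \<in> mverts G \<and> u \<noteq> v"
    and opposite_arcs: "(u, v) \<in> marcs G \<Longrightarrow> (v, u) \<in> marcs G \<Longrightarrow> {u, v} \<in> medges G"

definition assoc_digraph :: "'a pre_mixed_graph \<Rightarrow> 'a pair_pre_digraph" where
  "assoc_digraph G =
     \<lparr> pverts = mverts G, parcs = marcs G \<union> {(u, v). {u, v} \<in> medges G} \<rparr>"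

definition mwalk :: "'a pre_mixed_graph \<Rightarrow> 'a vwalk \<Rightarrow> bool" where
  "mwalk G w \<longleftrightarrow> w \<noteq> [] \<and> set w \<subseteq> mverts G \<and>
     (\<forall>(u, v) \<in> set (vwalk_arcs w). {u, v} \<in> medges G \<or> (u, v) \<in> marcs G)"

definition undirected_walk :: "'a pre_mixed_graph \<Rightarrow> 'a vwalk \<Rightarrow> bool" where
  "undirected_walk G w \<longleftrightarrow> mwalk G w \<and> (\<forall>(u, v) \<in> set (vwalk_arcs w). {u, v} \<in> medges G)"

text \<open>The conjugate of a walk \<open>w\<close> is \<open>rev w\<close>.\<close>

definition iterated_line_digraph :: "nat \<Rightarrow> 'a pair_pre_digraph \<Rightarrow> 'a vwalk pair_pre_digraph" where
  "iterated_line_digraph l D =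
     \<lparr> pverts = {u. vwalk u (with_proj D) \<and> vwalk_length u = l},
       parcs = {(u, tl u @ [v]) | u v.
         vwalk u (with_proj D) \<and> vwalk_length u = l \<and> (last u, v) \<in> parcs D} \<rparr>"

text \<open>
  Vertices of the sequence mixed graph are represented as the sets of walks that are regarded as
  the same vertex.
\<close>

definition seq_vertex :: "'a pre_mixed_graph \<Rightarrow> 'a vwalk \<Rightarrow> 'a vwalk set" where
  "seq_vertex G u = (if undirected_walk G u then {u, rev u} else {u})"

definition seq_step :: "'a pre_mixed_graph \<Rightarrow> nat \<Rightarrow> 'a vwalk \<Rightarrow> 'a vwalk set \<Rightarrow> 'a vwalk set \<Rightarrow> bool"
  where "seq_step G l w x y \<longleftrightarrow> mwalk G w \<and> vwalk_length w = l + 1 \<and>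
     x = seq_vertex G (butlast w) \<and> y = seq_vertex G (tl w)"

definition seq_mixed_graph :: "nat \<Rightarrow> 'a pre_mixed_graph \<Rightarrow> 'a vwalk set pre_mixed_graph" where
  "seq_mixed_graph l G =
     \<lparr> mverts = {seq_vertex G u | u. mwalk G u \<and> vwalk_length u = l},
       medges = {{x, y} | x y. x \<noteq> y \<and> (\<exists>w. seq_step G l w x y \<and> undirected_walk G w)},
       marcs = {(x, y). x \<noteq> y \<and> (\<exists>w. seq_step G l w x y) \<and>
                        \<not> (\<exists>w. seq_step G l w x y \<and> undirected_walk G w)} \<rparr>"

text \<open>
  The digraph obtained by identifying the vertices of \<open>D\<close> related by the equivalence relation
  \<open>R\<close>; loops are discarded.
\<close>

definition identify_verts :: "'b rel \<Rightarrow> 'b pair_pre_digraph \<Rightarrow> 'b set pair_pre_digraph" where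
  "identify_verts R D =
     \<lparr> pverts = pverts D // R,
       parcs = {(R `` {x}, R `` {y}) | x y. (x, y) \<in> parcs D \<and> R `` {x} \<noteq> R `` {y}} \<rparr>"

definition conjugate_rel :: "'a vwalk pair_pre_digraph \<Rightarrow> 'a vwalk rel" where
  "conjugate_rel D = {(u, v). u \<in> pverts D \<and> v \<in> pverts D \<and> (v = u \<or> v = rev u)}"

lemma equiv_conjugate_rel: "equiv (pverts D) (conjugate_rel D)"
  by (rule equivI) (auto simp: conjugate_rel_def refl_on_def sym_def trans_def)

definition digons_to_edges :: "'b pair_pre_digraph \<Rightarrow> 'b pre_mixed_graph" where
  "digons_to_edges D =
     \<lparr> mverts = pverts D,
       medges = {{x, y} | x y. x \<noteq> y \<and> (x, y) \<in> parcs D \<and> (y, x) \<in> parcs D},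
       marcs = {(x, y) \<in> parcs D. (y, x) \<notin> parcs D} \<rparr>"

end

theory Submission
  imports Defs
begin

text \<open>
  A walk is undirected exactly when its conjugate is a walk too, because two opposite arcs always
  come with an edge. Hence the classes of the conjugation relation are the vertices of the sequence
  mixed graph, and identified arcs are the steps along walks of length \<open>l + 1\<close>. The content
  is that a digon between distinct classes stems from an undirected walk of length \<open>l + 1\<close>:
  if neither class is undirected, a walk realising one arc has period two and so retraces itself;
  if exactly one is, the only doubtful arc is retraced, or the directed walk would be a palindrome.
\<close>

section \<open>Walks by position, and their reversal\<close>

lemma set_vwalk_arcs_nth: "set (vwalk_arcs w) = {(w ! i, w ! Suc i) | i. Suc i < length w}"
proof (induction w rule: vwalk_arcs.induct)
  case (3 a b w)
  have "{(f i, f (Suc i)) | i. Suc i < Suc (Suc n)} =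
      insert (f 0, f 1) {(f (Suc i), f (Suc (Suc i))) | i. Suc i < Suc n}"
    for f :: "nat \<Rightarrow> 'a" and n
    by (auto simp: less_Suc_eq_0_disj)
  from this[of "\<lambda>i. (a # b # w) ! i" "length w"] 3 show ?case
    by simp
qed auto

text \<open>Adjacency in the associated digraph. Both walks and undirected walks are expressed
  through this one relation, which makes reversal a matter of indices.\<close>

definition arc_or_edge :: "'a pre_mixed_graph \<Rightarrow> 'a \<Rightarrow> 'a \<Rightarrow> bool" where
  "arc_or_edge G u v \<longleftrightarrow> {u, v} \<in> medges G \<or> (u, v) \<in> marcs G"

lemma mwalk_nth:
  "mwalk G w \<longleftrightarrow> w \<noteq> [] \<and> set w \<subseteq> mverts G \<and>
     (\<forall>i. Suc i < length w \<longrightarrow> arc_or_edge G (w ! i) (w ! Suc i))"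
  unfolding mwalk_def set_vwalk_arcs_nth arc_or_edge_def by blast

text \<open>This is where \<open>opposite_arcs\<close> enters: the edges can be read off the
  associated digraph.\<close>

lemma (in mixed_graph) edge_iff_opposite:
  "{u, v} \<in> medges G \<longleftrightarrow> arc_or_edge G u v \<and> arc_or_edge G v u"
  using opposite_arcs[of u v] by (auto simp: arc_or_edge_def insert_commute)

lemma (in mixed_graph) undirected_walk_nth:
  "undirected_walk G w \<longleftrightarrow> w \<noteq> [] \<and> set w \<subseteq> mverts G \<and>
     (\<forall>i. Suc i < length w \<longrightarrow> arc_or_edge G (w ! i) (w ! Suc i) \<and> arc_or_edge G (w ! Suc i) (w ! i))"
  unfolding undirected_walk_def set_vwalk_arcs_nth mwalk_nth edge_iff_opposite
  by blast

lemma (in mixed_graph) undirected_walk_iff: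
  "undirected_walk G w \<longleftrightarrow> mwalk G w \<and> mwalk G (rev w)"
proof -
  have "(\<forall>i. Suc i < length w \<longrightarrow> arc_or_edge G (w ! Suc i) (w ! i)) \<longleftrightarrow>
      (\<forall>i. Suc i < length (rev w) \<longrightarrow> arc_or_edge G (rev w ! i) (rev w ! Suc i))" (is "?L \<longleftrightarrow> ?R")
  proof
    assume L: ?L
    show ?R
    proof (intro allI impI)
      fix i assume "Suc i < length (rev w)"
      \<comment> \<open>Step \<open>i\<close> of \<open>rev w\<close> is step
        \<open>length w - 2 - i\<close> of \<open>w\<close>, traversed backwards.\<close>
      then have i: "Suc (length w - Suc (Suc i)) = length w - Suc i" "Suc i < length w" by auto
      with L[rule_format, of "length w - Suc (Suc i)"]
      show "arc_or_edge G (rev w ! i) (rev w ! Suc i)" by (simp add: rev_nth)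
    qed
  next
    assume R: ?R
    show ?L
    proof (intro allI impI)
      fix i assume i: "Suc i < length w"
      then have "Suc (length w - Suc (Suc i)) = length w - Suc i" by auto
      with i R[rule_format, of "length w - Suc (Suc i)"]
      show "arc_or_edge G (w ! Suc i) (w ! i)" by (simp add: rev_nth)
    qed
  qed
  then show ?thesis
    unfolding undirected_walk_nth mwalk_nth by auto
qed

section \<open>Walks in the associated digraph\<close>

lemma vwalk_assoc_digraph: "vwalk w (with_proj (assoc_digraph G)) \<longleftrightarrow> mwalk G w"
  by (auto simp: vwalk_def mwalk_def assoc_digraph_def arcs_ends_def arc_to_ends_def)

lemma parcs_assoc_digraph: "(u, v) \<in> parcs (assoc_digraph G) \<longleftrightarrow> arc_or_edge G u v"
  by (auto simp: assoc_digraph_def arc_or_edge_def)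

lemma mwalk_butlast: "mwalk G w \<Longrightarrow> 2 \<le> length w \<Longrightarrow> mwalk G (butlast w)"
  by (cases w rule: rev_cases) (auto simp: mwalk_nth nth_append split: if_splits)

lemma mwalk_tl: "mwalk G w \<Longrightarrow> 2 \<le> length w \<Longrightarrow> mwalk G (tl w)"
  by (cases w) (auto simp: mwalk_nth)

lemma (in mixed_graph) mwalk_snoc_iff:
  assumes "mwalk G u"
  shows "mwalk G (u @ [v]) \<longleftrightarrow> arc_or_edge G (last u) v"
proof
  from assms have "u \<noteq> []" by (simp add: mwalk_nth)
  then have last: "u ! (length u - 1) = last u" by (simp add: last_conv_nth)
  {
    assume "mwalk G (u @ [v])"
    with \<open>u \<noteq> []\<close> last show "arc_or_edge G (last u) v"
      by (auto simp: mwalk_nth nth_append dest: spec[of _ "length u - 1"])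
  next
    assume arc: "arc_or_edge G (last u) v"
    \<comment> \<open>A walk must stay inside \<open>mverts G\<close>; for the new vertex this comes
      from the well-formedness of edges and arcs.\<close>
    then have "v \<in> mverts G"
      using arc_wf[of "last u" v] edge_wf[of "{last u, v}"]
      by (auto simp: arc_or_edge_def doubleton_eq_iff)
    moreover have "i = length u - 1" if "Suc i < Suc (length u)" "\<not> Suc i < length u" for i
      using that by simp
    ultimately show "mwalk G (u @ [v])"
      using assms arc last by (auto simp: mwalk_nth nth_append)
  }
qed

section \<open>Classes of conjugate walks\<close>

lemma (in mixed_graph) seq_vertex_eq_iff:
  assumes "mwalk G u" "mwalk G v"
  shows "seq_vertex G u = seq_vertex G v \<longleftrightarrow> v = u \<or> (undirected_walk G u \<and> v = rev u)"
  using assms by (auto simp: seq_vertex_def undirected_walk_iff doubleton_eq_iff)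

lemma (in mixed_graph) seq_vertex_rev:
  "undirected_walk G u \<Longrightarrow> seq_vertex G (rev u) = seq_vertex G u"
  by (auto simp: seq_vertex_def undirected_walk_iff)

text \<open>By \<open>undirected_walk_iff\<close>, \<open>rev u\<close> is a vertex of the line
  digraph exactly when \<open>u\<close> is undirected.\<close>

lemma (in mixed_graph) conjugate_class:
  assumes "mwalk G u" "vwalk_length u = l"
  shows "conjugate_rel (iterated_line_digraph l (assoc_digraph G)) `` {u} = seq_vertex G u"
  using assms
  by (auto simp: conjugate_rel_def iterated_line_digraph_def vwalk_assoc_digraph seq_vertex_def
      undirected_walk_iff vwalk_length_def)

text \<open>Reversal exchanges \<open>butlast\<close> and \<open>tl\<close> up to conjugation, and
  conjugate undirected walks have the same class.\<close>

lemma (in mixed_graph) undirected_seq_step_sym: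
  assumes "seq_step G l w x y" "undirected_walk G w" "1 \<le> l"
  shows "seq_step G l (rev w) y x" "undirected_walk G (rev w)"
proof -
  from assms have len: "2 \<le> length w" and w: "mwalk G w" "mwalk G (rev w)"
    by (auto simp: seq_step_def undirected_walk_iff vwalk_length_def)
  have bt: "butlast (rev w) = rev (tl w)" and tb: "tl (rev w) = rev (butlast w)"
    by (metis butlast_rev, metis rev_rev_ident butlast_rev)
  have "undirected_walk G (tl w)" "undirected_walk G (butlast w)"
    using w len mwalk_tl[of G w] mwalk_butlast[of G "rev w"] mwalk_butlast[of G w] mwalk_tl[of G "rev w"]
    by (simp_all add: undirected_walk_iff bt tb)
  with assms w show "seq_step G l (rev w) y x"
    by (auto simp: seq_step_def bt tb seq_vertex_rev vwalk_length_def)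
  show "undirected_walk G (rev w)"
    using w by (simp add: undirected_walk_iff)
qed

section \<open>Digons come from undirected walks\<close>

text \<open>With at least three vertices the first step lies in \<open>butlast w\<close> and every
  other step in \<open>tl w\<close>.\<close>

lemma (in mixed_graph) undirected_walk_if_ends:
  assumes "undirected_walk G (butlast w)" "undirected_walk G (tl w)" "3 \<le> length w"
  shows "undirected_walk G w"
proof -
  obtain a b c u where w: "w = a # b # c # u"
    using assms(3) by (auto simp: numeral_3_eq_3 Suc_le_length_iff)
  have "arc_or_edge G a b \<and> arc_or_edge G b a" "a \<in> mverts G"
    using assms(1) by (auto simp: undirected_walk_nth w)
  with assms(2) show ?thesis
    by (auto simp: undirected_walk_nth w nth_Cons split: nat.split)
qed

text \<open>The walk alternates between two vertices, so each step is retraced by the next one, and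
  the last step by the one before it.\<close>

lemma (in mixed_graph) undirected_walk_period_two:
  assumes w: "mwalk G w" and len: "3 \<le> length w" and p: "butlast (butlast w) = tl (tl w)"
  shows "undirected_walk G w"
proof -
  have per: "w ! Suc (Suc i) = w ! i" if "Suc (Suc i) < length w" for i
  proof -
    from that have "tl (tl w) ! i = w ! Suc (Suc i)" by (simp add: nth_tl)
    moreover from that have "butlast (butlast w) ! i = w ! i" by (simp add: nth_butlast)
    ultimately show ?thesis using p by simp
  qed
  have "arc_or_edge G (w ! Suc i) (w ! i)" if "Suc i < length w" for i
  proof (cases "Suc (Suc i) < length w")
    case True
    with w per[of i] show ?thesis by (auto simp: mwalk_nth)
  next
    case False
    with that len obtain j where "i = Suc j" by (cases i) auto
    with w per[of j] that show ?thesis by (auto simp: mwalk_nth)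
  qed
  with w show ?thesis by (auto simp: undirected_walk_nth mwalk_nth)
qed

lemma (in mixed_graph) undirected_if_digon_from_directed:
  assumes w: "seq_step G l w x y" and w': "seq_step G l w' y x" and l: "1 \<le> l"
    and x: "\<not> undirected_walk G (butlast w)"
  shows "undirected_walk G w"
proof -
  from w w' l have len: "length w = l + 2" "length w' = l + 2"
    and mw: "mwalk G w" "mwalk G w'"
    by (auto simp: seq_step_def vwalk_length_def)
  with l have ends: "mwalk G (butlast w)" "mwalk G (tl w)" "mwalk G (butlast w')" "mwalk G (tl w')"
    by (auto intro: mwalk_tl mwalk_butlast)
  \<comment> \<open>The class \<open>x\<close> is a singleton, so both walks must use the same
    representative of it; for \<open>y\<close> a conjugate remains possible.\<close>
  have tl': "tl w' = butlast w"
    using w w' x ends by (auto simp: seq_step_def seq_vertex_eq_iff)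
  have bl': "butlast w' = tl w \<or> (undirected_walk G (tl w) \<and> butlast w' = rev (tl w))"
    using w w' ends by (simp add: seq_step_def seq_vertex_eq_iff)
  then show ?thesis
  proof (elim disjE conjE)
    assume bl: "butlast w' = tl w"
    \<comment> \<open>Both sides equal \<open>butlast (tl w') = tl (butlast w')\<close>.\<close>
    have "butlast (butlast w) = tl (tl w)"
      using tl' bl by (metis butlast_tl)
    with mw len l show ?thesis by (intro undirected_walk_period_two) auto
  next
    assume bl: "butlast w' = rev (tl w)"
    obtain a m b where wm: "w = a # m @ [b]"
      using len by (metis Suc_length_conv add_2_eq_Suc' append_butlast_last_id length_0_conv nat.distinct(1))
    have "m \<noteq> []" using len l wm by auto
    obtain c where "w' = c # a # m"
      using tl' wm len by (cases w') (auto simp: butlast_append)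
    \<comment> \<open>The equation \<open>bl\<close> now reads
      \<open>c # butlast (a # m) = b # rev m\<close>; compare the tails.\<close>
    with bl wm have "butlast (a # m) = rev m" by (cases "m = []") auto
    then have am: "a # m = rev m @ [last m]"
      using \<open>m \<noteq> []\<close> by (metis append_butlast_last_id last_ConsR list.distinct(1))
    moreover from this \<open>m \<noteq> []\<close> have "a = last m"
      by (metis append_is_Nil_conv hd_append2 hd_rev list.sel(1) rev_is_Nil_conv)
    ultimately have "rev (butlast w) = butlast w"
      by (simp add: wm butlast_append)
    \<comment> \<open>A palindrome is its own conjugate, hence undirected, contrary to the
      assumption \<open>x\<close>.\<close>
    with x ends show ?thesis by (simp add: undirected_walk_iff)
  qed
qed

lemma (in mixed_graph) undirected_step_if_digon:
  assumes w: "seq_step G l w x y" and w': "seq_step G l w' y x" and l: "1 \<le> l"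
  shows "\<exists>w. seq_step G l w x y \<and> undirected_walk G w"
proof (cases "undirected_walk G (butlast w)")
  case False
  with assms undirected_if_digon_from_directed show ?thesis by blast
next
  case x: True
  show ?thesis
  proof (cases "undirected_walk G (tl w)")
    case True
    moreover from w l have "3 \<le> length w" by (auto simp: seq_step_def vwalk_length_def)
    ultimately have "undirected_walk G w"
      using x undirected_walk_if_ends by blast
    with w show ?thesis by blast
  next
    case False
    from w w' l have len: "length w = l + 2" "length w' = l + 2"
      and mw: "mwalk G w" "mwalk G w'"
      by (auto simp: seq_step_def vwalk_length_def)
    with l have ends: "mwalk G (tl w)" "mwalk G (butlast w')"
      by (auto intro: mwalk_tl mwalk_butlast)
    have "seq_vertex G (tl w) = seq_vertex G (butlast w')"
      using w w' by (simp add: seq_step_def)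
    with ends False have "\<not> undirected_walk G (butlast w')"
      by (auto simp: seq_vertex_eq_iff)
    \<comment> \<open>Now \<open>y\<close> is the class that is not undirected, so \<open>w\<close>
      and \<open>w'\<close> exchange roles. The walk sought from \<open>x\<close> to
      \<open>y\<close> is then \<open>rev w'\<close>, not \<open>w\<close> itself.\<close>
    then have "undirected_walk G w'"
      using undirected_if_digon_from_directed w' w l by blast
    with w' l show ?thesis using undirected_seq_step_sym by blast
  qed
qed

section \<open>Arcs of the quotient and the final comparison\<close>

text \<open>An arc of the line digraph amounts to a walk \<open>w\<close> of length
  \<open>l + 1\<close>, with tail \<open>butlast w\<close> and head \<open>tl w\<close>;
  identification replaces these by their classes. Both constructions discard loops.\<close>

lemma (in mixed_graph) parcs_identify_conjugates:
  assumes "1 \<le> l"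
  shows "(x, y) \<in> parcs (identify_verts (conjugate_rel (iterated_line_digraph l (assoc_digraph G)))
      (iterated_line_digraph l (assoc_digraph G))) \<longleftrightarrow> x \<noteq> y \<and> (\<exists>w. seq_step G l w x y)"
    (is "_ \<in> parcs (identify_verts (conjugate_rel ?D) ?D) \<longleftrightarrow> _")
proof -
  have parcs: "(u, u') \<in> parcs ?D \<longleftrightarrow>
      (\<exists>w. mwalk G w \<and> vwalk_length w = l + 1 \<and> u = butlast w \<and> u' = tl w)" for u u'
  proof
    assume "(u, u') \<in> parcs ?D"
    then obtain v where "mwalk G u" "vwalk_length u = l" "u' = tl u @ [v]" "arc_or_edge G (last u) v"
      by (auto simp: iterated_line_digraph_def vwalk_assoc_digraph parcs_assoc_digraph)
    moreover from this have "mwalk G (u @ [v])" "u \<noteq> []"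
      by (simp_all add: mwalk_snoc_iff mwalk_nth[of G u])
    ultimately show "\<exists>w. mwalk G w \<and> vwalk_length w = l + 1 \<and> u = butlast w \<and> u' = tl w"
      by (intro exI[of _ "u @ [v]"]) (auto simp: vwalk_length_def Suc_diff_le Suc_le_eq)
  next
    assume "\<exists>w. mwalk G w \<and> vwalk_length w = l + 1 \<and> u = butlast w \<and> u' = tl w"
    then obtain w where w: "mwalk G w" "vwalk_length w = l + 1" "u = butlast w" "u' = tl w"
      by blast
    from w assms have len: "length w = l + 2" by (simp add: vwalk_length_def)
    with w have u: "mwalk G u" "vwalk_length u = l"
      by (simp_all add: mwalk_butlast vwalk_length_def)
    from len w have snoc: "w = u @ [last w]"
      by (metis add_2_eq_Suc' append_butlast_last_id list.size(3) nat.distinct(1))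
    have "u \<noteq> []" using u by (simp add: mwalk_nth)
    with snoc w have "u' = tl u @ [last w]" by (metis tl_append2)
    moreover have "arc_or_edge G (last u) (last w)"
      using snoc w u mwalk_snoc_iff by metis
    ultimately show "(u, u') \<in> parcs ?D"
      using u
      by (auto simp: iterated_line_digraph_def vwalk_assoc_digraph parcs_assoc_digraph)
  qed
  have cls: "conjugate_rel ?D `` {butlast w} = seq_vertex G (butlast w)"
      "conjugate_rel ?D `` {tl w} = seq_vertex G (tl w)"
    if "mwalk G w" "vwalk_length w = l + 1" for w
    using that by (auto intro!: conjugate_class mwalk_butlast mwalk_tl simp: vwalk_length_def)
  have "(x, y) \<in> parcs (identify_verts (conjugate_rel ?D) ?D) \<longleftrightarrow> x \<noteq> y \<and>
      (\<exists>u u'. (u, u') \<in> parcs ?D \<and> x = conjugate_rel ?D `` {u} \<and> y = conjugate_rel ?D `` {u'})"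
    by (auto simp: identify_verts_def)
  also have "\<dots> \<longleftrightarrow> x \<noteq> y \<and> (\<exists>w. seq_step G l w x y)"
  proof -
    have "(\<exists>u u'. (\<exists>w. mwalk G w \<and> vwalk_length w = l + 1 \<and> u = butlast w \<and> u' = tl w) \<and>
        x = conjugate_rel ?D `` {u} \<and> y = conjugate_rel ?D `` {u'}) \<longleftrightarrow>
      (\<exists>w. mwalk G w \<and> vwalk_length w = l + 1 \<and>
        x = conjugate_rel ?D `` {butlast w} \<and> y = conjugate_rel ?D `` {tl w})"
      by blast
    \<comment> \<open>\<open>conj_cong\<close> makes the walk conditions on \<open>w\<close>
      available, as \<open>cls\<close> requires.\<close>
    also have "\<dots> \<longleftrightarrow> (\<exists>w. seq_step G l w x y)"
      unfolding seq_step_def by (intro ex_cong1 conj_cong refl) (simp_all only: cls)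
    finally show ?thesis unfolding parcs by simp
  qed
  finally show ?thesis .
qed

theorem theorem3p3:
  fixes G :: "'a pre_mixed_graph" and l :: nat
  assumes "mixed_graph G" and "l \<ge> 1"
  shows "seq_mixed_graph l G =
    digons_to_edges
      (identify_verts (conjugate_rel (iterated_line_digraph l (assoc_digraph G)))
        (iterated_line_digraph l (assoc_digraph G)))"
proof -
  interpret mixed_graph G by fact
  let ?D = "iterated_line_digraph l (assoc_digraph G)"
  let ?Q = "identify_verts (conjugate_rel ?D) ?D"
  \<comment> \<open>Left to right is \<open>undirected_step_if_digon\<close>; conversely, reversing
    an undirected walk supplies the opposite arc. Edges thus agree, and the remaining arcs are those
    whose opposite is missing.\<close>
  have digon: "(x, y) \<in> parcs ?Q \<and> (y, x) \<in> parcs ?Q \<longleftrightarrow>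
      x \<noteq> y \<and> (\<exists>w. seq_step G l w x y \<and> undirected_walk G w)" for x y
    unfolding parcs_identify_conjugates[OF assms(2)]
    using undirected_step_if_digon undirected_seq_step_sym(1) assms(2) by blast
  have "mverts (seq_mixed_graph l G) = pverts ?Q"
  proof -
    have "pverts ?D = {u. mwalk G u \<and> vwalk_length u = l}"
      by (simp add: iterated_line_digraph_def vwalk_assoc_digraph)
    then show ?thesis
      by (auto simp: seq_mixed_graph_def identify_verts_def quotient_def conjugate_class)
  qed
  moreover have "medges (seq_mixed_graph l G) =
      {{x, y} | x y. x \<noteq> y \<and> (x, y) \<in> parcs ?Q \<and> (y, x) \<in> parcs ?Q}"
    unfolding digon by (simp add: seq_mixed_graph_def)
  moreover have "marcs (seq_mixed_graph l G) = {(x, y) \<in> parcs ?Q. (y, x) \<notin> parcs ?Q}"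
  proof (intro set_eqI)
    fix a show "a \<in> marcs (seq_mixed_graph l G) \<longleftrightarrow> a \<in> {(x, y) \<in> parcs ?Q. (y, x) \<notin> parcs ?Q}"
      using digon[of "fst a" "snd a"] parcs_identify_conjugates[OF assms(2), of "fst a" "snd a"]
      by (cases a) (simp add: seq_mixed_graph_def, blast)
  qed
  ultimately show ?thesis
    by (simp add: digons_to_edges_def)
qed

end
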